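(* Suppose that $F : \mathsf C \to \mathsf D$ is a separable functor which preserves monomorphisms. Let $M$ be an object of $\mathsf C$ such that $M$ is subobject nontrivial and $F(M)$ is subobject simple in $\mathsf D$. Then $M$ is subobject simple in $\mathsf C$.
   Context: Functors are covariant. A functor $F:\mathsf C\to\mathsf D$ is separable if for all objects $M,N$ of $\mathsf C$ there is a function $R_{M,N}:\mathrm{Hom}_{\mathsf D}(F(M),F(N))\to\mathrm{Hom}_{\mathsf C}(M,N)$ such that (SF1) $R_{M,N}(F(h))=h$ for all $h:M\to N$ in $\mathsf C$; and (SF2) for all $h:M\to M'$, $g:N\to N'$ in $\mathsf C$ and $h':F(M)\to F(N)$, $g':F(M')\to F(N')$ in $\mathsf D$, if $F(g)h'=g'F(h)$ then $g\,R_{M,N}(h')=R_{M',N'}(g')\,h$. For an object $M$ of a category $\mathsf C$, monomorphisms $f:P\to M$ and $g:Q\to M$ are equivalent if $f=gh$ for some isomorphism $h:P\to Q$. The equivalence classes are the subobjects of $M$; their collection is $\mathrm{Sub}_{\mathsf C}(M)$. $M$ is subobject nontrivial if $|\mathrm{Sub}_{\mathsf C}(M)|\ge 2$ and subobject simple if $|\mathrm{Sub}_{\mathsf C}(M)|=2$. *)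

theory Defs
  imports "HOL-Library.FuncSet"
begin

record ('o, 'a) cat =
  Obj :: "'o set"
  Arr :: "'a set"
  Dom :: "'a \<Rightarrow> 'o"
  Cod :: "'a \<Rightarrow> 'o"
  Idn :: "'o \<Rightarrow> 'a"
  Comp :: "'a \<Rightarrow> 'a \<Rightarrow> 'a"  (infixl "\<cdot>\<index>" 70)

definition Hom :: "('o, 'a, 'm) cat_scheme \<Rightarrow> 'o \<Rightarrow> 'o \<Rightarrow> 'a set" where
  "Hom C M N = {f \<in> Arr C. Dom C f = M \<and> Cod C f = N}"

text \<open>Composition is written in the usual order, first \<open>f\<close> and then \<open>g\<close> in \<open>g \<cdot> f\<close>; its
  value on non-composable arrows is irrelevant.\<close>

locale category =
  fixes C (structure)
  assumes dom_in_Obj: "f \<in> Arr C \<Longrightarrow> Dom C f \<in> Obj C"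
    and cod_in_Obj: "f \<in> Arr C \<Longrightarrow> Cod C f \<in> Obj C"
    and id_in_Hom: "M \<in> Obj C \<Longrightarrow> Idn C M \<in> Hom C M M"
    and comp_in_Hom: "\<lbrakk>f \<in> Hom C L M; g \<in> Hom C M N\<rbrakk> \<Longrightarrow> g \<cdot> f \<in> Hom C L N"
    and comp_assoc: "\<lbrakk>f \<in> Hom C K L; g \<in> Hom C L M; h \<in> Hom C M N\<rbrakk>
      \<Longrightarrow> (h \<cdot> g) \<cdot> f = h \<cdot> (g \<cdot> f)"
    and comp_id_right: "f \<in> Hom C M N \<Longrightarrow> f \<cdot> Idn C M = f"
    and comp_id_left: "f \<in> Hom C M N \<Longrightarrow> Idn C N \<cdot> f = f"

definition mono_arr :: "('o, 'a, 'm) cat_scheme \<Rightarrow> 'a \<Rightarrow> bool" where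
  "mono_arr C f \<longleftrightarrow> f \<in> Arr C \<and>
    (\<forall>L \<in> Obj C. \<forall>u \<in> Hom C L (Dom C f). \<forall>v \<in> Hom C L (Dom C f).
      f \<cdot>\<^bsub>C\<^esub> u = f \<cdot>\<^bsub>C\<^esub> v \<longrightarrow> u = v)"

definition iso_arr :: "('o, 'a, 'm) cat_scheme \<Rightarrow> 'a \<Rightarrow> bool" where
  "iso_arr C h \<longleftrightarrow> h \<in> Arr C \<and>
    (\<exists>k \<in> Hom C (Cod C h) (Dom C h).
      k \<cdot>\<^bsub>C\<^esub> h = Idn C (Dom C h) \<and> h \<cdot>\<^bsub>C\<^esub> k = Idn C (Cod C h))"

definition monos_into :: "('o, 'a, 'm) cat_scheme \<Rightarrow> 'o \<Rightarrow> 'a set" where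
  "monos_into C M = {f. mono_arr C f \<and> Cod C f = M}"

definition mono_equiv :: "('o, 'a, 'm) cat_scheme \<Rightarrow> 'o \<Rightarrow> ('a \<times> 'a) set" where
  "mono_equiv C M = {(f, g). f \<in> monos_into C M \<and> g \<in> monos_into C M \<and>
    (\<exists>h \<in> Hom C (Dom C f) (Dom C g). iso_arr C h \<and> f = g \<cdot>\<^bsub>C\<^esub> h)}"

definition Sub :: "('o, 'a, 'm) cat_scheme \<Rightarrow> 'o \<Rightarrow> 'a set set" where
  "Sub C M = monos_into C M // mono_equiv C M"

text \<open>The first disjunct is needed because \<^const>\<open>card\<close> is \<open>0\<close> on infinite sets.\<close>

definition subobject_nontrivial :: "('o, 'a, 'm) cat_scheme \<Rightarrow> 'o \<Rightarrow> bool" where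
  "subobject_nontrivial C M \<longleftrightarrow> infinite (Sub C M) \<or> card (Sub C M) \<ge> 2"

definition subobject_simple :: "('o, 'a, 'm) cat_scheme \<Rightarrow> 'o \<Rightarrow> bool" where
  "subobject_simple C M \<longleftrightarrow> card (Sub C M) = 2"

record ('o, 'a, 'p, 'b) cat_map =
  on_obj :: "'o \<Rightarrow> 'p"
  on_arr :: "'a \<Rightarrow> 'b"

locale covariant_functor = C: category C + D: category D
  for C :: "('o, 'a, 'm) cat_scheme" and D :: "('p, 'b, 'n) cat_scheme" +
  fixes F :: "('o, 'a, 'p, 'b) cat_map"
  assumes on_obj_in_Obj: "M \<in> Obj C \<Longrightarrow> on_obj F M \<in> Obj D"
    and on_arr_in_Hom: "f \<in> Hom C M N \<Longrightarrow> on_arr F f \<in> Hom D (on_obj F M) (on_obj F N)"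
    and on_arr_id: "M \<in> Obj C \<Longrightarrow> on_arr F (Idn C M) = Idn D (on_obj F M)"
    and on_arr_comp: "\<lbrakk>f \<in> Hom C L M; g \<in> Hom C M N\<rbrakk>
      \<Longrightarrow> on_arr F (g \<cdot>\<^bsub>C\<^esub> f) = on_arr F g \<cdot>\<^bsub>D\<^esub> on_arr F f"

text \<open>The maps \<open>R M N\<close> form one family, since the second condition relates \<open>R M N\<close> and
  \<open>R M' N'\<close>.\<close>

locale separable_functor = covariant_functor +
  assumes separable:
    "\<exists>R. (\<forall>M \<in> Obj C. \<forall>N \<in> Obj C.
           R M N \<in> Hom D (on_obj F M) (on_obj F N) \<rightarrow> Hom C M N) \<and>
         (\<forall>M \<in> Obj C. \<forall>N \<in> Obj C. \<forall>h \<in> Hom C M N. R M N (on_arr F h) = h) \<and>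
         (\<forall>M \<in> Obj C. \<forall>M' \<in> Obj C. \<forall>N \<in> Obj C. \<forall>N' \<in> Obj C.
           \<forall>h \<in> Hom C M M'. \<forall>g \<in> Hom C N N'.
           \<forall>h' \<in> Hom D (on_obj F M) (on_obj F N).
           \<forall>g' \<in> Hom D (on_obj F M') (on_obj F N').
             on_arr F g \<cdot>\<^bsub>D\<^esub> h' = g' \<cdot>\<^bsub>D\<^esub> on_arr F h \<longrightarrow>
             g \<cdot>\<^bsub>C\<^esub> R M N h' = R M' N' g' \<cdot>\<^bsub>C\<^esub> h)"

definition preserves_monos ::
  "('o, 'a, 'm) cat_scheme \<Rightarrow> ('p, 'b, 'n) cat_scheme \<Rightarrow> ('o, 'a, 'p, 'b) cat_map \<Rightarrow> bool" where
  "preserves_monos C D F \<longleftrightarrow> (\<forall>f. mono_arr C f \<longrightarrow> mono_arr D (on_arr F f))"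

end

theory Submission imports Defs begin

text \<open>The monomorphisms into \<open>M\<close> are preordered by factorization, and two of them define the same
  subobject exactly when each factors through the other (lemma \<open>mono_equiv_iff_factors_through\<close>).
  A functor always preserves factorizations. A separable functor also reflects them: if
  \<open>F g \<cdot> h' = F f\<close>, where \<open>f\<close> and \<open>g\<close> have codomain \<open>M\<close>, then the square with sides \<open>h'\<close>, \<open>F g\<close>,
  \<open>F f\<close> and the identity of \<open>F M\<close> commutes, and (SF2) turns it into a factorization
  \<open>g \<cdot> R h' = f\<close> (lemma \<open>separable_reflects_factorization\<close>). If moreover \<open>F\<close> preserves
  monomorphisms, it follows that \<open>F\<close> is injective on subobjects, so that \<open>M\<close> has at most as many
  subobjects as \<open>F M\<close>. When \<open>F M\<close> has two, \<open>M\<close> has at most two, and a subobject nontrivial \<open>M\<close> has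
  exactly two.\<close>

definition factors_through :: "('o, 'a, 'm) cat_scheme \<Rightarrow> 'a \<Rightarrow> 'a \<Rightarrow> bool" where
  "factors_through C f g \<longleftrightarrow> (\<exists>h \<in> Hom C (Dom C f) (Dom C g). f = g \<cdot>\<^bsub>C\<^esub> h)"

lemma monos_into_Hom: "f \<in> monos_into C M \<Longrightarrow> f \<in> Hom C (Dom C f) M"
  by (auto simp: monos_into_def mono_arr_def Hom_def)

lemma monos_into_cancel:
  assumes "f \<in> monos_into C M" "L \<in> Obj C" "u \<in> Hom C L (Dom C f)" "v \<in> Hom C L (Dom C f)"
    and "f \<cdot>\<^bsub>C\<^esub> u = f \<cdot>\<^bsub>C\<^esub> v"
  shows "u = v"
  using assms by (auto simp: monos_into_def mono_arr_def)

context category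
begin

lemma monos_into_Dom: "f \<in> monos_into C M \<Longrightarrow> Dom C f \<in> Obj C"
  by (auto simp: monos_into_def mono_arr_def dom_in_Obj)

text \<open>A monic \<open>f\<close> can be cancelled in \<open>f = g \<cdot> h = f \<cdot> (k \<cdot> h)\<close>.\<close>

lemma factorizations_inverse:
  assumes f: "f \<in> monos_into C M" and g: "g \<in> monos_into C M"
    and h: "h \<in> Hom C (Dom C f) (Dom C g)" "f = g \<cdot> h"
    and k: "k \<in> Hom C (Dom C g) (Dom C f)" "g = f \<cdot> k"
  shows "k \<cdot> h = Idn C (Dom C f)"
proof (rule monos_into_cancel[OF f])
  note P = monos_into_Dom[OF f]
  show "Dom C f \<in> Obj C" by (fact P)
  show "k \<cdot> h \<in> Hom C (Dom C f) (Dom C f)" using h k comp_in_Hom by blast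
  show "Idn C (Dom C f) \<in> Hom C (Dom C f) (Dom C f)" using P by (rule id_in_Hom)
  have "f \<cdot> (k \<cdot> h) = (f \<cdot> k) \<cdot> h"
    using comp_assoc[OF h(1) k(1) monos_into_Hom[OF f]] by simp
  also have "\<dots> = f" using h(2) k(2) by simp
  also have "\<dots> = f \<cdot> Idn C (Dom C f)"
    using comp_id_right[OF monos_into_Hom[OF f]] by simp
  finally show "f \<cdot> (k \<cdot> h) = f \<cdot> Idn C (Dom C f)" .
qed

text \<open>In the forward direction the second factorization is through the inverse of the given
  isomorphism; in the backward direction the two mediating arrows are inverse to each other because
  both arrows are monic.\<close>

lemma mono_equiv_iff_factors_through:
  "(f, g) \<in> mono_equiv C M \<longleftrightarrow>
    f \<in> monos_into C M \<and> g \<in> monos_into C M \<and> factors_through C f g \<and> factors_through C g f"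
  (is "?L \<longleftrightarrow> ?R")
proof
  assume ?L
  then obtain h where f: "f \<in> monos_into C M" and g: "g \<in> monos_into C M"
    and h: "h \<in> Hom C (Dom C f) (Dom C g)" and iso: "iso_arr C h" and fg: "f = g \<cdot> h"
    by (auto simp: mono_equiv_def)
  have dc: "Dom C h = Dom C f" "Cod C h = Dom C g" using h by (auto simp: Hom_def)
  from iso obtain k where k: "k \<in> Hom C (Dom C g) (Dom C f)" and hk: "h \<cdot> k = Idn C (Dom C g)"
    unfolding iso_arr_def dc by blast
  have "f \<cdot> k = g \<cdot> (h \<cdot> k)"
    using comp_assoc[OF k h monos_into_Hom[OF g]] fg by simp
  also have "\<dots> = g" using hk comp_id_right[OF monos_into_Hom[OF g]] by simp
  finally have "g = f \<cdot> k" by simp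
  with f g h fg k show ?R unfolding factors_through_def by blast
next
  assume ?R
  then obtain h k where f: "f \<in> monos_into C M" and g: "g \<in> monos_into C M"
    and h: "h \<in> Hom C (Dom C f) (Dom C g)" "f = g \<cdot> h"
    and k: "k \<in> Hom C (Dom C g) (Dom C f)" "g = f \<cdot> k"
    unfolding factors_through_def by blast
  have "k \<cdot> h = Idn C (Dom C f)" "h \<cdot> k = Idn C (Dom C g)"
    using factorizations_inverse[OF f g h k] factorizations_inverse[OF g f k h] .
  with h(1) k(1) have "iso_arr C h" by (auto simp: iso_arr_def Hom_def)
  with f g h show ?L by (auto simp: mono_equiv_def)
qed

lemma factors_through_refl:
  assumes "f \<in> monos_into C M"
  shows "factors_through C f f"
  unfolding factors_through_def
  using id_in_Hom[OF monos_into_Dom[OF assms]] comp_id_right[OF monos_into_Hom[OF assms]] by metis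

lemma factors_through_trans:
  assumes "factors_through C e f" "factors_through C f g" "g \<in> monos_into C M"
  shows "factors_through C e g"
proof -
  obtain h k where h: "h \<in> Hom C (Dom C e) (Dom C f)" "e = f \<cdot> h"
    and k: "k \<in> Hom C (Dom C f) (Dom C g)" "f = g \<cdot> k"
    using assms(1,2) unfolding factors_through_def by blast
  have "e = g \<cdot> (k \<cdot> h)"
    using comp_assoc[OF h(1) k(1) monos_into_Hom[OF assms(3)]] h(2) k(2) by simp
  with comp_in_Hom[OF h(1) k(1)] show ?thesis unfolding factors_through_def by blast
qed

lemma equiv_mono_equiv: "equiv (monos_into C M) (mono_equiv C M)"
proof (rule equivI)
  show "mono_equiv C M \<subseteq> monos_into C M \<times> monos_into C M"
    by (auto simp: mono_equiv_def)
  show "refl_on (monos_into C M) (mono_equiv C M)"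
    by (auto simp: refl_on_def mono_equiv_iff_factors_through factors_through_refl)
  show "sym (mono_equiv C M)"
    by (auto simp: sym_def mono_equiv_iff_factors_through)
  show "trans (mono_equiv C M)"
    unfolding trans_def mono_equiv_iff_factors_through
    using factors_through_trans by blast
qed

end

context separable_functor
begin

text \<open>Condition (SF2) is applied to \<open>F g \<cdot> h' = id \<cdot> F f\<close>; since \<open>id\<close> is the image of the identity
  of \<open>M\<close>, (SF1) removes \<open>R\<close> from the right-hand side.\<close>

lemma separable_reflects_factorization:
  assumes f: "f \<in> Hom C P M" and g: "g \<in> Hom C Q M"
    and h': "h' \<in> Hom D (on_obj F P) (on_obj F Q)"
    and eq: "on_arr F f = on_arr F g \<cdot>\<^bsub>D\<^esub> h'"
  shows "\<exists>h \<in> Hom C P Q. f = g \<cdot>\<^bsub>C\<^esub> h"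
proof -
  from separable obtain R where
    R: "\<forall>M \<in> Obj C. \<forall>N \<in> Obj C.
      R M N \<in> Hom D (on_obj F M) (on_obj F N) \<rightarrow> Hom C M N"
    and SF1: "\<forall>M \<in> Obj C. \<forall>N \<in> Obj C. \<forall>h \<in> Hom C M N. R M N (on_arr F h) = h"
    and SF2: "\<forall>M \<in> Obj C. \<forall>M' \<in> Obj C. \<forall>N \<in> Obj C. \<forall>N' \<in> Obj C.
      \<forall>h \<in> Hom C M M'. \<forall>g \<in> Hom C N N'.
      \<forall>h' \<in> Hom D (on_obj F M) (on_obj F N). \<forall>g' \<in> Hom D (on_obj F M') (on_obj F N').
        on_arr F g \<cdot>\<^bsub>D\<^esub> h' = g' \<cdot>\<^bsub>D\<^esub> on_arr F h \<longrightarrow>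
        g \<cdot>\<^bsub>C\<^esub> R M N h' = R M' N' g' \<cdot>\<^bsub>C\<^esub> h"
    by (elim exE conjE)
  have P: "P \<in> Obj C" and M: "M \<in> Obj C" and Q: "Q \<in> Obj C"
    using f g C.dom_in_Obj C.cod_in_Obj by (auto simp: Hom_def)
  let ?i = "Idn D (on_obj F M)"
  have i: "?i \<in> Hom D (on_obj F M) (on_obj F M)"
    using M by (intro D.id_in_Hom on_obj_in_Obj)
  have "on_arr F g \<cdot>\<^bsub>D\<^esub> h' = ?i \<cdot>\<^bsub>D\<^esub> on_arr F f"
    using eq D.comp_id_left[OF on_arr_in_Hom[OF f]] by simp
  then have "g \<cdot>\<^bsub>C\<^esub> R P Q h' = R M M ?i \<cdot>\<^bsub>C\<^esub> f"
    by (rule SF2[rule_format, OF P M Q M f g h' i])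
  also have "R M M ?i = Idn C M"
    using SF1[rule_format, OF M M C.id_in_Hom[OF M]] on_arr_id[OF M] by simp
  also have "Idn C M \<cdot>\<^bsub>C\<^esub> f = f" using f by (rule C.comp_id_left)
  finally show ?thesis using R[rule_format, OF P Q] h' by force
qed

lemma factors_through_reflected:
  assumes f: "f \<in> Hom C P M" and g: "g \<in> Hom C Q M"
    and "factors_through D (on_arr F f) (on_arr F g)"
  shows "factors_through C f g"
proof -
  have "Dom C f = P" "Dom C g = Q"
    "Dom D (on_arr F f) = on_obj F P" "Dom D (on_arr F g) = on_obj F Q"
    using f g on_arr_in_Hom[OF f] on_arr_in_Hom[OF g] by (auto simp: Hom_def)
  with assms(3) show ?thesis
    unfolding factors_through_def using separable_reflects_factorization[OF f g] by auto
qed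

lemma monos_into_preserved:
  assumes "preserves_monos C D F" and f: "f \<in> monos_into C M"
  shows "on_arr F f \<in> monos_into D (on_obj F M)"
  using assms on_arr_in_Hom[OF monos_into_Hom[OF f]]
  by (auto simp: preserves_monos_def monos_into_def Hom_def)

lemma mono_equiv_reflected:
  assumes "f \<in> monos_into C M" and "g \<in> monos_into C M"
    and "(on_arr F f, on_arr F g) \<in> mono_equiv D (on_obj F M)"
  shows "(f, g) \<in> mono_equiv C M"
  using assms factors_through_reflected[OF monos_into_Hom monos_into_Hom]
  unfolding C.mono_equiv_iff_factors_through D.mono_equiv_iff_factors_through by blast

text \<open>The injection sends a subobject to the class of the image of a chosen representative, so that
  independence of the choice is not at issue: equal classes have equivalent images of
  representatives, and equivalence is reflected.\<close>

lemma Sub_injection: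
  assumes pm: "preserves_monos C D F"
  shows "\<exists>\<phi>. inj_on \<phi> (Sub C M) \<and> \<phi> ` Sub C M \<subseteq> Sub D (on_obj F M)"
proof -
  have "\<forall>S \<in> Sub C M. \<exists>f \<in> monos_into C M. S = mono_equiv C M `` {f}"
    by (auto simp: Sub_def elim: quotientE)
  then obtain r where r: "\<And>S. S \<in> Sub C M \<Longrightarrow> r S \<in> monos_into C M"
    and S: "\<And>S. S \<in> Sub C M \<Longrightarrow> S = mono_equiv C M `` {r S}"
    by metis
  define \<phi> where "\<phi> S = mono_equiv D (on_obj F M) `` {on_arr F (r S)}" for S
  have "inj_on \<phi> (Sub C M)"
  proof (rule inj_onI)
    fix S T assume ST: "S \<in> Sub C M" "T \<in> Sub C M" and "\<phi> S = \<phi> T"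
    then have "(on_arr F (r S), on_arr F (r T)) \<in> mono_equiv D (on_obj F M)"
      unfolding \<phi>_def
      using eq_equiv_class[OF _ D.equiv_mono_equiv] monos_into_preserved[OF pm r] by blast
    then have "(r S, r T) \<in> mono_equiv C M"
      using mono_equiv_reflected r ST by blast
    then show "S = T"
      using S[OF ST(1)] S[OF ST(2)] equiv_class_eq[OF C.equiv_mono_equiv] by metis
  qed
  moreover have "\<phi> ` Sub C M \<subseteq> Sub D (on_obj F M)"
    using monos_into_preserved[OF pm r] by (auto simp: \<phi>_def Sub_def intro: quotientI)
  ultimately show ?thesis by blast
qed

end

theorem proposition16:
  fixes C :: "('o, 'a) cat" and D :: "('p, 'b) cat"
    and F :: "('o, 'a, 'p, 'b) cat_map" and M :: 'o
  assumes "separable_functor C D F"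
    and "preserves_monos C D F"
    and "M \<in> Obj C"
    and "subobject_nontrivial C M"
    and "subobject_simple D (on_obj F M)"
  shows "subobject_simple C M"
proof -
  from assms(1) interpret separable_functor C D F .
  obtain \<phi> where \<phi>: "inj_on \<phi> (Sub C M)" "\<phi> ` Sub C M \<subseteq> Sub D (on_obj F M)"
    using Sub_injection[OF assms(2)] by blast
  have two: "card (Sub D (on_obj F M)) = 2"
    using assms(5) by (simp add: subobject_simple_def)
  then have "finite (Sub D (on_obj F M))"
    by (metis card.infinite zero_neq_numeral)
  then have "finite (Sub C M)" and "card (Sub C M) \<le> 2"
    using \<phi> two inj_on_finite card_inj_on_le by metis+
  with assms(4) show ?thesis
    by (simp add: subobject_nontrivial_def subobject_simple_def)
qed

end
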